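(* Let $n\ge1$ and let $\delta=1/L$ with $L\ge 2$ an integer. Let $u:\{0,\delta,2\delta,\dots,1\}\times(\delta\mathbb{Z})^n\to\mathbb{R}$ be a function that is $\delta$-discrete harmonic in the strip $S^\delta$, i.e. $\Delta_{\delta,n+1}u(\delta k,\delta j)=0$ for all $k=1,\dots,L-1$ and $j\in\mathbb{Z}^n$. Suppose that $$|u(x,y)|=o\big(\exp(b_\delta\|y\|_1)\big),\qquad \|y\|_1\to\infty,$$ where $b_\delta>0$ is defined by $$\cosh(\delta b_\delta)=\frac{n+1}{n}-\frac1n\cos(\pi\delta).$$ Suppose moreover that $$\sum_{j\in\mathbb{Z}^n}|u(0,\delta j)|^2<\infty\quad\text{and}\quad\sum_{j\in\mathbb{Z}^n}|u(1,\delta j)|^2<\infty .$$ Then $\{u(\delta k,\delta j)\}_{j\in\mathbb{Z}^n}\in l^2(\mathbb{Z}^n)$ for each $k=1,2,\dots,L-1$, i.e. $u$ is tempered, and moreover for each such $k$ $$\sum_{j\in\mathbb{Z}^n}|u(\delta k,\delta j)|^2\le\sum_{j\in\mathbb{Z}^n}|u(0,\delta j)|^2+\sum_{j\in\mathbb{Z}^n}|u(1,\delta j)|^2 .$$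
   Context: For $y\in\mathbb{R}^n$, $\|y\|_1=|y_1|+\dots+|y_n|$. Points of $(\delta\mathbb{Z})^{n+1}$ are written $(x,y)$ with $x\in\delta\mathbb{Z}$, $y\in(\delta\mathbb{Z})^n$. The $\delta$-discrete Laplacian on $(\delta\mathbb{Z})^m$ is $$\Delta_{\delta,m}u(z)=\delta^{-2}\Big(\sum_{i=1}^m\big(u(z+\delta e_i)+u(z-\delta e_i)\big)-2m\,u(z)\Big),$$ with $e_1,\dots,e_m$ the standard basis. The strip is $S=(0,1)\times\mathbb{R}^n$ and $S^\delta=S\cap(\delta\mathbb{Z})^{n+1}$. A function $u$ on the discrete strip is called tempered if $\sum_{k=0}^{1/\delta}\sum_{j\in\mathbb{Z}^n}|u(\delta k,\delta j)|^2<\infty$. The $o(\cdot)$ condition means: for every $\varepsilon>0$ there is $R>0$ such that $|u(x,y)|\le\varepsilon\exp(b_\delta\|y\|_1)$ for all $x\in\{0,\delta,\dots,1\}$ and all $y\in(\delta\mathbb{Z})^n$ with $\|y\|_1\ge R$. *)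

theory Defs
  imports "HOL-Analysis.Analysis"
begin

definition norm_1 :: "real ^ 'n \<Rightarrow> real" where
  "norm_1 y = (\<Sum>i\<in>UNIV. \<bar>y $ i\<bar>)"

definition scaled_lattice :: "real \<Rightarrow> 'a::euclidean_space set" where
  "scaled_lattice \<delta> = {z. \<forall>e\<in>Basis. \<exists>j::int. z \<bullet> e = \<delta> * of_int j}"

definition lattice_vec :: "real \<Rightarrow> int ^ 'n \<Rightarrow> real ^ 'n" where
  "lattice_vec \<delta> j = (\<chi> i. \<delta> * of_int (j $ i))"

text \<open>On the type \<open>real \<times> (real ^ 'n)\<close>, \<open>Basis\<close> is the standard basis of the
  (n+1)-dimensional space, where n = \<open>CARD('n)\<close>. Grid functions are represented by total
  functions; the values off the grid never enter.\<close>

definition discrete_laplacian :: "real \<Rightarrow> ('a::euclidean_space \<Rightarrow> real) \<Rightarrow> 'a \<Rightarrow> real" where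
  "discrete_laplacian \<delta> u z =
     ((\<Sum>e\<in>Basis. u (z + \<delta> *\<^sub>R e) + u (z - \<delta> *\<^sub>R e)) - 2 * real DIM('a) * u z) / \<delta>\<^sup>2"

definition discrete_harmonic_on ::
    "real \<Rightarrow> 'a::euclidean_space set \<Rightarrow> ('a \<Rightarrow> real) \<Rightarrow> bool" where
  "discrete_harmonic_on \<delta> A u \<longleftrightarrow> (\<forall>z\<in>A. discrete_laplacian \<delta> u z = 0)"

definition discrete_strip :: "real \<Rightarrow> (real \<times> (real ^ 'n)) set" where
  "discrete_strip \<delta> = ({0<..<1} \<times> UNIV) \<inter> scaled_lattice \<delta>"

definition little_o_exp ::
    "nat \<Rightarrow> real \<Rightarrow> (real \<times> (real ^ 'n) \<Rightarrow> real) \<Rightarrow> bool" where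
  "little_o_exp L b u \<longleftrightarrow>
     (\<forall>\<epsilon>>0. \<exists>R>0. \<forall>k\<in>{0..L}. \<forall>y\<in>scaled_lattice (1 / real L). norm_1 y \<ge> R \<longrightarrow>
        \<bar>u (real k / real L, y)\<bar> \<le> \<epsilon> * exp (b * norm_1 y))"

text \<open>The square sum over \<open>{0..L} \<times> \<int>\<^sup>n\<close> is finite; \<open>summable_on\<close> means unconditional
  summability over the index set.\<close>

definition tempered :: "nat \<Rightarrow> (real \<times> (real ^ 'n) \<Rightarrow> real) \<Rightarrow> bool" where
  "tempered L u \<longleftrightarrow>
     (\<lambda>(k, j). \<bar>u (real k / real L, lattice_vec (1 / real L) j)\<bar>\<^sup>2)
       summable_on ({0..L} \<times> (UNIV :: (int ^ 'n) set))"

end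

theory Submission
  imports Defs
begin

text \<open>The proof uses only a Phragmen-Lindelof principle for discrete subharmonic functions on
  the strip, and no Fourier analysis. Rescale the grid to \<open>{0..L} \<times> \<int>\<^sup>n\<close> and let \<open>\<delta> = 1 / L\<close>.

  The equation for \<open>b\<close> says exactly that
  \<open>h(k,j) = sin (\<pi>k/L) \<Prod>\<^sub>i cosh (\<delta> b j\<^sub>i)\<close> is discrete harmonic. This \<open>h\<close> vanishes on both
  boundary layers, and on the interior layers it dominates a constant multiple of
  \<open>exp (b \<delta> \<parallel>j\<parallel>\<^sub>1)\<close>. Hence, if \<open>w\<close> is subharmonic, at most \<open>M \<ge> 0\<close> on the boundary layers and
  bounded above by \<open>o(exp (b \<delta> \<parallel>j\<parallel>\<^sub>1))\<close>, then for every \<open>\<epsilon> > 0\<close> the maximum principle applied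
  to \<open>w - M - \<epsilon> h\<close>, which is positive at finitely many points only, gives \<open>w \<le> M + \<epsilon> h\<close>, and
  \<open>\<epsilon> \<rightarrow> 0\<close> gives \<open>w \<le> M\<close> (\<open>strip_phragmen_lindelof\<close>).

  The principle is applied twice. Square summable boundary values are bounded, so, applied to
  \<open>u\<close> and \<open>-u\<close>, it shows that \<open>u\<close> is bounded. Then for a finite set \<open>F \<subseteq> \<int>\<^sup>n\<close> the function
  \<open>W(k,j) = (\<Sum>m\<in>F. u(k,j+m)\<^sup>2)\<close> is bounded, subharmonic as a sum of squares of harmonic
  functions, and on the boundary layers at most the larger of the two boundary square sums.
  Applied to \<open>W\<close>, the principle bounds \<open>W(k,0) = (\<Sum>m\<in>F. u(k,m)\<^sup>2)\<close> by that number,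
  uniformly in \<open>F\<close> (\<open>strip_harmonic_sum_squares_le\<close>). This bound is stronger than the
  required one, which has the sum of the two boundary square sums.\<close>

section \<open>Discrete subharmonic functions on a strip\<close>

text \<open>The sum of \<open>w\<close> over the \<open>2(n+1)\<close> neighbours of \<open>(k,j)\<close>, with \<open>n = CARD('n)\<close>. Layers are
  indexed by natural numbers, so the truncated \<open>k - 1\<close> makes this a genuine sum over neighbours
  only for \<open>k \<ge> 1\<close>.\<close>

definition neighbour_sum :: "(nat \<Rightarrow> int ^ 'n \<Rightarrow> real) \<Rightarrow> nat \<Rightarrow> int ^ 'n \<Rightarrow> real" where
  "neighbour_sum w k j =
     w (k - 1) j + w (k + 1) j + (\<Sum>i\<in>UNIV. w k (j + axis i 1) + w k (j - axis i 1))"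

text \<open>The mean value inequality on the interior layers \<open>0 < k < L\<close>; the layers \<open>0\<close> and \<open>L\<close> are
  the boundary.\<close>

definition strip_subharmonic :: "nat \<Rightarrow> (nat \<Rightarrow> int ^ 'n \<Rightarrow> real) \<Rightarrow> bool" where
  "strip_subharmonic L w \<longleftrightarrow>
     (\<forall>k\<in>{1..<L}. \<forall>j. 2 * (real CARD('n) + 1) * w k j \<le> neighbour_sum w k j)"

text \<open>The mean value equality on the interior layers.\<close>

definition strip_harmonic :: "nat \<Rightarrow> (nat \<Rightarrow> int ^ 'n \<Rightarrow> real) \<Rightarrow> bool" where
  "strip_harmonic L w \<longleftrightarrow>
     (\<forall>k\<in>{1..<L}. \<forall>j. 2 * (real CARD('n) + 1) * w k j = neighbour_sum w k j)"

lemma neighbour_sum_diff: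
  "neighbour_sum (\<lambda>k j. v k j - w k j) k j = neighbour_sum v k j - neighbour_sum w k j"
  by (simp add: neighbour_sum_def sum.distrib sum_subtractf)

lemma neighbour_sum_cmult:
  "neighbour_sum (\<lambda>k j. c * w k j) k j = c * neighbour_sum w k j"
  by (simp add: neighbour_sum_def sum.distrib sum_distrib_left algebra_simps)

lemma neighbour_sum_sum:
  "neighbour_sum (\<lambda>k j. \<Sum>m\<in>F. w m k j) k j = (\<Sum>m\<in>F. neighbour_sum (w m) k j)"
  by (simp add: neighbour_sum_def sum.distrib sum.swap[of _ F])

lemma neighbour_sum_const:
  "neighbour_sum (\<lambda>k (j :: int ^ 'n). c) k j = 2 * (real CARD('n) + 1) * c"
  by (simp add: neighbour_sum_def algebra_simps)

lemma neighbour_sum_translate: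
  "neighbour_sum (\<lambda>k j. w k (j + m)) k j = neighbour_sum w k (j + m)"
  by (simp add: neighbour_sum_def algebra_simps)

lemma neighbour_sum_le:
  fixes w :: "nat \<Rightarrow> int ^ 'n \<Rightarrow> real"
  assumes "w (k + 1) j \<le> Z" "\<And>m. w k m \<le> Z"
  shows "neighbour_sum w k j \<le> w (k - 1) j + (2 * real CARD('n) + 1) * Z"
proof -
  have "(\<Sum>i\<in>UNIV. w k (j + axis i 1) + w k (j - axis i 1)) \<le> (\<Sum>i\<in>(UNIV :: 'n set). Z + Z)"
    by (intro sum_mono add_mono assms)
  then show ?thesis
    using assms(1) by (simp add: neighbour_sum_def algebra_simps)
qed

text \<open>The finiteness hypothesis replaces compactness: it makes a positive maximum attained.\<close>

lemma strip_maximum_principle: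
  fixes z :: "nat \<Rightarrow> int ^ 'n \<Rightarrow> real"
  assumes sub: "strip_subharmonic L z"
    and left: "\<And>j. z 0 j \<le> 0" and right: "\<And>j. z L j \<le> 0"
    and fin: "finite {j. \<exists>k\<le>L. z k j > 0}"
    and k: "k \<le> L"
  shows "z k j \<le> 0"
proof (rule ccontr)
  assume pos: "\<not> z k j \<le> 0"
  define P where "P = {(k, j). k \<le> L \<and> z k j > 0}"
  have "P \<subseteq> {..L} \<times> {j. \<exists>k\<le>L. z k j > 0}"
    by (auto simp: P_def)
  then have finP: "finite P"
    using fin finite_subset by blast
  have "(k, j) \<in> P"
    using pos k by (simp add: P_def)
  then have neP: "P \<noteq> {}" by blast
  define Z where "Z = Max ((\<lambda>(k, j). z k j) ` P)"
  have Zin: "Z \<in> (\<lambda>(k, j). z k j) ` P"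
    unfolding Z_def using finP neP by (intro Max_in) auto
  then obtain k1 j1 where k1: "k1 \<le> L" "z k1 j1 = Z" and Zpos: "Z > 0"
    by (auto simp: P_def)
  have le: "z k j \<le> Z" if "k \<le> L" for k j
  proof (cases "z k j > 0")
    case True
    then have "(k, j) \<in> P" using that by (simp add: P_def)
    then have "z k j \<in> (\<lambda>(k, j). z k j) ` P" by force
    then show ?thesis unfolding Z_def using finP by (intro Max_ge) auto
  next
    case False
    then show ?thesis using Zpos by simp
  qed
  \<comment> \<open>The first layer on which the maximum is attained is interior, but the mean value
    inequality passes the maximum on to the layer before it.\<close>
  define k0 where "k0 = (LEAST k. \<exists>j. z k j = Z)"
  have "\<exists>j. z k0 j = Z"
    unfolding k0_def by (rule LeastI[of _ k1]) (use k1 in auto)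
  then obtain j0 where j0: "z k0 j0 = Z" by blast
  have "k0 \<le> k1"
    unfolding k0_def by (rule Least_le) (use k1 in auto)
  moreover have "k0 \<noteq> 0" using j0 left[of j0] Zpos by (metis not_le)
  moreover have "k0 \<noteq> L" using j0 right[of j0] Zpos by (metis not_le)
  ultimately have k0: "1 \<le> k0" "k0 < L" using k1 by auto
  have "2 * (real CARD('n) + 1) * Z \<le> neighbour_sum z k0 j0"
    using sub k0 j0 unfolding strip_subharmonic_def by (metis atLeastLessThan_iff)
  also have "\<dots> \<le> z (k0 - 1) j0 + (2 * real CARD('n) + 1) * Z"
    by (rule neighbour_sum_le) (use k0 le in auto)
  finally have "Z \<le> z (k0 - 1) j0" by (simp add: algebra_simps)
  then have "z (k0 - 1) j0 = Z"
    using le[of "k0 - 1" j0] k0 by simp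
  then have "k0 \<le> k0 - 1"
    unfolding k0_def by (intro Least_le) blast
  then show False using k0 by simp
qed

section \<open>The harmonic barrier\<close>

lemma norm_1_lattice_vec:
  "\<delta> > 0 \<Longrightarrow> norm_1 (lattice_vec \<delta> j) = (\<Sum>i\<in>UNIV. \<delta> * \<bar>of_int (j $ i)\<bar>)"
  by (simp add: norm_1_def lattice_vec_def abs_mult)

lemma finite_lattice_norm_1_less:
  assumes "\<delta> > 0"
  shows "finite {j :: int ^ 'n. norm_1 (lattice_vec \<delta> j) < R}"
proof -
  define N where "N = \<lceil>R / \<delta>\<rceil>"
  have "{j :: int ^ 'n. norm_1 (lattice_vec \<delta> j) < R} \<subseteq>
          (\<lambda>f. \<chi> i. f i) ` (PiE UNIV (\<lambda>_. {-N..N}))"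
  proof
    fix j :: "int ^ 'n"
    assume "j \<in> {j. norm_1 (lattice_vec \<delta> j) < R}"
    then have lt: "(\<Sum>i\<in>UNIV. \<delta> * \<bar>of_int (j $ i)\<bar>) < R"
      using assms by (simp add: norm_1_lattice_vec)
    have "j $ i \<in> {-N..N}" for i
    proof -
      have "\<delta> * \<bar>of_int (j $ i)\<bar> \<le> (\<Sum>i\<in>UNIV. \<delta> * \<bar>of_int (j $ i)\<bar>)"
        by (rule member_le_sum) (use assms in auto)
      then have "\<bar>real_of_int (j $ i)\<bar> \<le> R / \<delta>"
        using lt assms by (simp add: field_simps)
      then have "\<bar>real_of_int (j $ i)\<bar> \<le> of_int N"
        unfolding N_def using le_of_int_ceiling order_trans by blast
      then show ?thesis by auto
    qed
    then have "(\<lambda>i. j $ i) \<in> PiE UNIV (\<lambda>_. {-N..N})" by auto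
    moreover have "j = (\<chi> i. j $ i)" by (simp add: vec_eq_iff)
    ultimately show "j \<in> (\<lambda>f. \<chi> i. f i) ` (PiE UNIV (\<lambda>_. {-N..N}))" by blast
  qed
  then show ?thesis
    by (rule finite_subset) (intro finite_imageI finite_PiE, auto)
qed

text \<open>The function \<open>sin (\<pi>k/L) \<Prod>\<^sub>i cosh (a j\<^sub>i)\<close>, zero on the boundary layers and
  positive on the interior ones; it is used with \<open>a = \<delta> b\<close>.\<close>

definition barrier :: "nat \<Rightarrow> real \<Rightarrow> nat \<Rightarrow> int ^ 'n \<Rightarrow> real" where
  "barrier L a k j = sin (pi * real k / real L) * (\<Prod>i\<in>UNIV. cosh (a * of_int (j $ i)))"

lemma sin_add_sin_double: "sin (x + t) + sin (x - t) = 2 * cos t * sin (x :: real)"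
  by (simp add: sin_add sin_diff)

lemma prod_cosh_shift:
  fixes j :: "int ^ 'n" and a :: real
  shows "(\<Prod>m\<in>UNIV. cosh (a * of_int ((j + axis i 1) $ m))) +
         (\<Prod>m\<in>UNIV. cosh (a * of_int ((j - axis i 1) $ m))) =
         2 * cosh a * (\<Prod>m\<in>UNIV. cosh (a * of_int (j $ m)))"
proof -
  define Q where "Q = (\<Prod>m\<in>UNIV - {i}. cosh (a * of_int (j $ m)))"
  have split: "(\<Prod>m\<in>UNIV. cosh (a * of_int (v $ m))) =
          cosh (a * of_int (v $ i)) * (\<Prod>m\<in>UNIV - {i}. cosh (a * of_int (v $ m)))"
    for v :: "int ^ 'n"
    by (rule prod.remove) auto
  have plus: "(\<Prod>m\<in>UNIV - {i}. cosh (a * of_int ((j + axis i 1) $ m))) = Q"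
    unfolding Q_def by (rule prod.cong) (auto simp: axis_def)
  have minus: "(\<Prod>m\<in>UNIV - {i}. cosh (a * of_int ((j - axis i 1) $ m))) = Q"
    unfolding Q_def by (rule prod.cong) (auto simp: axis_def)
  have "cosh (a * of_int ((j + axis i 1) $ i)) + cosh (a * of_int ((j - axis i 1) $ i))
          = 2 * cosh a * cosh (a * of_int (j $ i))"
    by (simp add: ring_distribs cosh_add cosh_diff)
  then show ?thesis
    unfolding split[of "j + axis i 1"] split[of "j - axis i 1"] plus minus
    using split[of j] by (simp add: Q_def flip: distrib_right)
qed

lemma barrier_harmonic:
  assumes L: "L > 0"
    and a: "real CARD('n) * cosh a = real CARD('n) + 1 - cos (pi / real L)"
  shows "strip_harmonic L (barrier L a :: nat \<Rightarrow> int ^ 'n \<Rightarrow> real)"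
  unfolding strip_harmonic_def
proof (intro ballI allI)
  fix k and j :: "int ^ 'n"
  assume k: "k \<in> {1..<L}"
  define Q where "Q = (\<Prod>m\<in>UNIV. cosh (a * of_int (j $ m)))"
  define x where "x = pi * real k / real L"
  define t where "t = pi / real L"
  have x: "pi * real (k - 1) / real L = x - t" "pi * real (k + 1) / real L = x + t"
    using k L by (auto simp: x_def t_def of_nat_diff field_simps)
  have "barrier L a (k - 1) j + barrier L a (k + 1) j = (sin (x + t) + sin (x - t)) * Q"
    unfolding barrier_def x Q_def by (simp add: algebra_simps)
  also have "\<dots> = 2 * cos t * (sin x * Q)"
    unfolding sin_add_sin_double by simp
  finally have 1: "barrier L a (k - 1) j + barrier L a (k + 1) j = 2 * cos t * (sin x * Q)" .
  have 2: "barrier L a k (j + axis i 1) + barrier L a k (j - axis i 1) = 2 * cosh a * (sin x * Q)"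
    for i
    unfolding barrier_def distrib_left[symmetric] prod_cosh_shift x_def Q_def by simp
  have "neighbour_sum (barrier L a) k j
          = 2 * (cos t + real CARD('n) * cosh a) * (sin x * Q)"
    unfolding neighbour_sum_def 1 2 by (simp add: algebra_simps)
  also have "\<dots> = 2 * (real CARD('n) + 1) * barrier L a k j"
    unfolding a by (simp add: t_def barrier_def x_def Q_def)
  finally show "2 * (real CARD('n) + 1) * barrier L a k j = neighbour_sum (barrier L a) k j"
    by simp
qed

lemma exp_abs_le_cosh: "exp \<bar>x\<bar> \<le> 2 * cosh (x :: real)"
  by (auto simp: cosh_field_def abs_if)

lemma barrier_lower_bound:
  assumes "L > 0" "\<delta> > 0"
  shows "\<exists>C>0. \<forall>k\<in>{1..<L}. \<forall>j :: int ^ 'n.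
           exp (b * norm_1 (lattice_vec \<delta> j)) \<le> C * barrier L (\<delta> * b) k j"
proof -
  define s where "s = Min (insert 1 ((\<lambda>k. sin (pi * real k / real L)) ` {1..<L}))"
  have sin_pos: "sin (pi * real k / real L) > 0" if "k \<in> {1..<L}" for k
    by (rule sin_gt_zero) (use that in \<open>auto simp: field_simps\<close>)
  have s_pos: "s > 0"
    unfolding s_def using sin_pos by (subst Min_gr_iff) auto
  have s_le: "s \<le> sin (pi * real k / real L)" if "k \<in> {1..<L}" for k
    unfolding s_def using that by (intro Min_le) auto
  have "exp (b * norm_1 (lattice_vec \<delta> j)) \<le> 2 ^ CARD('n) / s * barrier L (\<delta> * b) k j"
    if k: "k \<in> {1..<L}" for k and j :: "int ^ 'n"
  proof -
    let ?Q = "\<Prod>i\<in>UNIV. cosh (\<delta> * b * of_int (j $ i))"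
    have Q: "?Q \<ge> 0" by (intro prod_nonneg) (auto intro: less_imp_le)
    have "exp (b * norm_1 (lattice_vec \<delta> j)) = (\<Prod>i\<in>UNIV. exp (b * (\<delta> * \<bar>of_int (j $ i)\<bar>)))"
      using assms by (simp add: norm_1_lattice_vec sum_distrib_left exp_sum)
    also have "\<dots> \<le> (\<Prod>i\<in>UNIV. 2 * cosh (\<delta> * b * of_int (j $ i)))"
    proof (intro prod_mono conjI)
      fix i
      have "b * (\<delta> * \<bar>of_int (j $ i)\<bar>) \<le> \<bar>\<delta> * b * of_int (j $ i)\<bar>"
        using assms by (simp add: abs_mult mult.assoc mult.left_commute mult_right_mono)
      then have "exp (b * (\<delta> * \<bar>of_int (j $ i)\<bar>)) \<le> exp \<bar>\<delta> * b * of_int (j $ i)\<bar>"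
        by simp
      also have "\<dots> \<le> 2 * cosh (\<delta> * b * of_int (j $ i))"
        by (rule exp_abs_le_cosh)
      finally show "exp (b * (\<delta> * \<bar>of_int (j $ i)\<bar>)) \<le> 2 * cosh (\<delta> * b * of_int (j $ i))" .
    qed simp
    also have "\<dots> = 2 ^ CARD('n) * ?Q" by (simp add: prod.distrib)
    also have "\<dots> \<le> 2 ^ CARD('n) / s * (sin (pi * real k / real L) * ?Q)"
    proof -
      have "s * ?Q \<le> sin (pi * real k / real L) * ?Q"
        by (intro mult_right_mono s_le k Q)
      then show ?thesis using s_pos by (simp add: field_simps)
    qed
    finally show ?thesis by (simp add: barrier_def)
  qed
  then show ?thesis using s_pos by (intro exI[of _ "2 ^ CARD('n) / s"]) auto
qed

section \<open>The Phragmen-Lindelof principle\<close>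

text \<open>Only an upper bound on the growth of \<open>w\<close> is needed.\<close>

lemma strip_phragmen_lindelof:
  fixes w :: "nat \<Rightarrow> int ^ 'n \<Rightarrow> real"
  assumes L: "L > 0" and \<delta>: "\<delta> > 0"
    and b: "real CARD('n) * cosh (\<delta> * b) = real CARD('n) + 1 - cos (pi / real L)"
    and sub: "strip_subharmonic L w"
    and M: "M \<ge> 0" and left: "\<And>j. w 0 j \<le> M" and right: "\<And>j. w L j \<le> M"
    and growth: "\<And>\<epsilon>. \<epsilon> > 0 \<Longrightarrow> \<exists>R. \<forall>k\<le>L. \<forall>j. norm_1 (lattice_vec \<delta> j) \<ge> R \<longrightarrow>
                   w k j \<le> \<epsilon> * exp (b * norm_1 (lattice_vec \<delta> j))"
    and k: "k \<le> L"
  shows "w k j \<le> M"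
proof -
  let ?h = "barrier L (\<delta> * b) :: nat \<Rightarrow> int ^ 'n \<Rightarrow> real"
  obtain C where C: "C > 0"
    "\<And>k j. k \<in> {1..<L} \<Longrightarrow> exp (b * norm_1 (lattice_vec \<delta> j)) \<le> C * ?h k j"
    using barrier_lower_bound[OF L \<delta>, of b] by metis
  have eps: "w k j \<le> M + \<epsilon> * (C * ?h k j)" if \<epsilon>: "\<epsilon> > 0" for \<epsilon>
  proof -
    define z where "z = (\<lambda>k j. w k j - (M + \<epsilon> * C * ?h k j))"
    have h: "2 * (real CARD('n) + 1) * ?h k j = neighbour_sum ?h k j" if "k \<in> {1..<L}" for k j
      using barrier_harmonic[OF L b] that unfolding strip_harmonic_def by blast
    have "neighbour_sum z k j =
        neighbour_sum w k j - 2 * (real CARD('n) + 1) * M - \<epsilon> * C * neighbour_sum ?h k j" for k j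
      using neighbour_sum_diff[of "\<lambda>k j. w k j - M" "\<lambda>k j. \<epsilon> * C * ?h k j" k j]
      by (simp add: z_def neighbour_sum_diff neighbour_sum_const neighbour_sum_cmult diff_diff_eq)
    moreover have "2 * (real CARD('n) + 1) * z k j = 2 * (real CARD('n) + 1) * w k j
        - 2 * (real CARD('n) + 1) * M - \<epsilon> * C * (2 * (real CARD('n) + 1) * ?h k j)" for k j
      by (simp add: z_def algebra_simps)
    ultimately have sub_z: "strip_subharmonic L z"
      using sub h unfolding strip_subharmonic_def by simp
    obtain R where R: "\<And>k j. k \<le> L \<Longrightarrow> norm_1 (lattice_vec \<delta> j) \<ge> R \<Longrightarrow>
                   w k j \<le> \<epsilon> * exp (b * norm_1 (lattice_vec \<delta> j))"
      using growth[OF \<epsilon>] by blast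
    have z_left: "z 0 j \<le> 0" for j using left[of j] by (simp add: z_def barrier_def)
    have z_right: "z L j \<le> 0" for j using right[of j] L by (simp add: z_def barrier_def)
    have far: "z k j \<le> 0" if "k \<le> L" "norm_1 (lattice_vec \<delta> j) \<ge> R" for k j
    proof (cases "k \<in> {1..<L}")
      case True
      have "w k j \<le> \<epsilon> * exp (b * norm_1 (lattice_vec \<delta> j))" using R that by blast
      also have "\<dots> \<le> \<epsilon> * (C * ?h k j)" using C(2)[OF True] \<epsilon> by simp
      finally show ?thesis using M by (simp add: z_def mult.assoc)
    next
      case False
      then have "k = 0 \<or> k = L" using that by auto
      then show ?thesis using z_left z_right by auto
    qed
    have "{j. \<exists>k\<le>L. z k j > 0} \<subseteq> {j. norm_1 (lattice_vec \<delta> j) < R}"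
      using far by (force simp: not_le[symmetric])
    then have "finite {j. \<exists>k\<le>L. z k j > 0}"
      using finite_lattice_norm_1_less[OF \<delta>] finite_subset by blast
    from strip_maximum_principle[OF sub_z z_left z_right this k, of j]
    show ?thesis by (simp add: z_def mult.assoc)
  qed
  have "((\<lambda>\<epsilon>. M + \<epsilon> * (C * ?h k j)) \<longlongrightarrow> M + 0 * (C * ?h k j)) (at_right 0)"
    by (intro tendsto_intros)
  moreover have "eventually (\<lambda>\<epsilon>. w k j \<le> M + \<epsilon> * (C * ?h k j)) (at_right 0)"
    unfolding eventually_at_right_field using eps by (intro exI[of _ 1]) auto
  ultimately show ?thesis
    using tendsto_lowerbound[of _ _ "at_right (0::real)"] by force
qed

section \<open>Square sums over the layers of a harmonic function\<close>

lemma neighbour_sum_square: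
  fixes w :: "nat \<Rightarrow> int ^ 'n \<Rightarrow> real"
  assumes "2 * (real CARD('n) + 1) * w k j = neighbour_sum w k j"
  shows "2 * (real CARD('n) + 1) * (w k j)\<^sup>2 \<le> neighbour_sum (\<lambda>k j. (w k j)\<^sup>2) k j"
proof -
  define c where "c = w k j"
  \<comment> \<open>The tangent to the square at the centre value has equality there, and it is affine, so
    its neighbour sum is known.\<close>
  have sq: "2 * c * x - c\<^sup>2 \<le> x\<^sup>2" for x :: real
    using sum_squares_bound[of c x] by simp
  have mono: "neighbour_sum (\<lambda>k j. 2 * c * w k j - c\<^sup>2) k j \<le> neighbour_sum (\<lambda>k j. (w k j)\<^sup>2) k j"
    unfolding neighbour_sum_def by (intro add_mono sum_mono sq)
  have "neighbour_sum (\<lambda>k j. 2 * c * w k j - c\<^sup>2) k j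
      = 2 * c * (2 * (real CARD('n) + 1) * c) - 2 * (real CARD('n) + 1) * c\<^sup>2"
    unfolding neighbour_sum_diff neighbour_sum_cmult neighbour_sum_const assms[symmetric] c_def ..
  also have "\<dots> = 2 * (real CARD('n) + 1) * c\<^sup>2" by (simp add: power2_eq_square algebra_simps)
  finally show ?thesis using mono by (simp add: c_def)
qed

lemma strip_harmonic_imp_subharmonic: "strip_harmonic L w \<Longrightarrow> strip_subharmonic L w"
  by (simp add: strip_harmonic_def strip_subharmonic_def)

lemma strip_harmonic_uminus: "strip_harmonic L w \<Longrightarrow> strip_harmonic L (\<lambda>k j. - w k j)"
  using neighbour_sum_cmult[of "-1" w] by (simp add: strip_harmonic_def)

text \<open>Every translate of \<open>w\<close> along the layers is harmonic, so its square is subharmonic.\<close>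

lemma strip_subharmonic_sum_squares:
  fixes w :: "nat \<Rightarrow> int ^ 'n \<Rightarrow> real"
  assumes "strip_harmonic L w"
  shows "strip_subharmonic L (\<lambda>k j. \<Sum>m\<in>F. (w k (j + m))\<^sup>2)"
  unfolding strip_subharmonic_def
proof (intro ballI allI)
  fix k and j :: "int ^ 'n"
  assume k: "k \<in> {1..<L}"
  have "2 * (real CARD('n) + 1) * (\<Sum>m\<in>F. (w k (j + m))\<^sup>2)
      = (\<Sum>m\<in>F. 2 * (real CARD('n) + 1) * (w k (j + m))\<^sup>2)"
    by (rule sum_distrib_left)
  also have "\<dots> \<le> (\<Sum>m\<in>F. neighbour_sum (\<lambda>k j. (w k j)\<^sup>2) k (j + m))"
    using assms k unfolding strip_harmonic_def by (intro sum_mono neighbour_sum_square) blast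
  also have "\<dots> = neighbour_sum (\<lambda>k j. \<Sum>m\<in>F. (w k (j + m))\<^sup>2) k j"
    unfolding neighbour_sum_sum
    by (simp only: neighbour_sum_translate[of "\<lambda>k j. (w k j)\<^sup>2"])
  finally show "2 * (real CARD('n) + 1) * (\<Sum>m\<in>F. (w k (j + m))\<^sup>2)
      \<le> neighbour_sum (\<lambda>k j. \<Sum>m\<in>F. (w k (j + m))\<^sup>2) k j" .
qed

lemma finite_sum_translate_le_infsum:
  fixes f :: "'a::ab_group_add \<Rightarrow> real"
  assumes "f summable_on UNIV" "\<And>j. f j \<ge> 0" "finite F"
  shows "(\<Sum>m\<in>F. f (j + m)) \<le> (\<Sum>\<^sub>\<infinity>j. f j)"
proof -
  have "(\<Sum>m\<in>F. f (j + m)) = sum f ((+) j ` F)"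
    by (simp add: sum.reindex)
  also have "\<dots> \<le> (\<Sum>\<^sub>\<infinity>j. f j)"
    using assms by (intro finite_sum_le_infsum) auto
  finally show ?thesis .
qed

text \<open>Summing over translates turns an \<open>l\<^sup>2\<close> bound into a pointwise one: the value at \<open>j = 0\<close> of
  the translated sum of squares is the partial sum over \<open>F\<close>.\<close>

lemma strip_harmonic_sum_squares_le:
  fixes w :: "nat \<Rightarrow> int ^ 'n \<Rightarrow> real"
  assumes L: "L > 0" and \<delta>: "\<delta> > 0" and b_pos: "b > 0"
    and b: "real CARD('n) * cosh (\<delta> * b) = real CARD('n) + 1 - cos (pi / real L)"
    and harm: "strip_harmonic L w"
    and left: "(\<lambda>j. (w 0 j)\<^sup>2) summable_on UNIV"
    and right: "(\<lambda>j. (w L j)\<^sup>2) summable_on UNIV"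
    and growth: "\<And>\<epsilon>. \<epsilon> > 0 \<Longrightarrow> \<exists>R. \<forall>k\<le>L. \<forall>j. norm_1 (lattice_vec \<delta> j) \<ge> R \<longrightarrow>
                   \<bar>w k j\<bar> \<le> \<epsilon> * exp (b * norm_1 (lattice_vec \<delta> j))"
    and k: "k \<le> L" and F: "finite F"
  shows "(\<Sum>j\<in>F. (w k j)\<^sup>2) \<le> max (\<Sum>\<^sub>\<infinity>j. (w 0 j)\<^sup>2) (\<Sum>\<^sub>\<infinity>j. (w L j)\<^sup>2)"
proof -
  define M where "M = max (\<Sum>\<^sub>\<infinity>j. (w 0 j)\<^sup>2) (\<Sum>\<^sub>\<infinity>j. (w L j)\<^sup>2)"
  have M: "M \<ge> 0" unfolding M_def by (simp add: infsum_nonneg le_max_iff_disj)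
  have bd_left: "(\<Sum>m\<in>G. (w 0 (j + m))\<^sup>2) \<le> M" if "finite G" for G j
    using finite_sum_translate_le_infsum[OF left _ that, of j] by (simp add: M_def)
  have bd_right: "(\<Sum>m\<in>G. (w L (j + m))\<^sup>2) \<le> M" if "finite G" for G j
    using finite_sum_translate_le_infsum[OF right _ that, of j] by (simp add: M_def)
  have abs_left: "\<bar>w 0 j\<bar> \<le> sqrt M" for j
    using bd_left[of "{0}" j] by (simp add: real_le_rsqrt)
  have abs_right: "\<bar>w L j\<bar> \<le> sqrt M" for j
    using bd_right[of "{0}" j] by (simp add: real_le_rsqrt)
  have bounded: "\<bar>w k j\<bar> \<le> sqrt M" if k: "k \<le> L" for k j
  proof -
    have "w k j \<le> sqrt M"
    proof (rule strip_phragmen_lindelof[OF L \<delta> b strip_harmonic_imp_subharmonic[OF harm] _ _ _ _ k])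
      show "\<exists>R. \<forall>k\<le>L. \<forall>j. norm_1 (lattice_vec \<delta> j) \<ge> R \<longrightarrow>
              w k j \<le> \<epsilon> * exp (b * norm_1 (lattice_vec \<delta> j))" if "\<epsilon> > 0" for \<epsilon>
        using growth[OF that] abs_le_D1 by meson
    qed (use M abs_left abs_right in \<open>auto simp: abs_le_iff\<close>)
    moreover have "- w k j \<le> sqrt M"
    proof (rule strip_phragmen_lindelof[OF L \<delta> b
          strip_harmonic_imp_subharmonic[OF strip_harmonic_uminus[OF harm]] _ _ _ _ k])
      show "\<exists>R. \<forall>k\<le>L. \<forall>j. norm_1 (lattice_vec \<delta> j) \<ge> R \<longrightarrow>
              - w k j \<le> \<epsilon> * exp (b * norm_1 (lattice_vec \<delta> j))" if "\<epsilon> > 0" for \<epsilon>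
        using growth[OF that] abs_le_D2 by meson
    qed (use M abs_left abs_right in \<open>auto simp: abs_le_iff\<close>)
    ultimately show ?thesis by simp
  qed
  have W_bounded: "(\<Sum>m\<in>F. (w k (j + m))\<^sup>2) \<le> real (card F) * M" if "k \<le> L" for k j
  proof (rule sum_bounded_above)
    show "(w k (j + m))\<^sup>2 \<le> M" for m
      using power_mono[OF bounded[OF that, of "j + m"], of 2] M by simp
  qed
  have "(\<Sum>m\<in>F. (w k (0 + m))\<^sup>2) \<le> M"
  proof (rule strip_phragmen_lindelof[OF L \<delta> b strip_subharmonic_sum_squares[OF harm] M _ _ _ k])
    fix \<epsilon> :: real assume \<epsilon>: "\<epsilon> > 0"
    define B where "B = real (card F) * M"
    \<comment> \<open>A bounded function is \<open>o(exp (b r))\<close> because \<open>b > 0\<close>.\<close>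
    have "B \<le> \<epsilon> * exp (b * r)" if "r \<ge> B / (\<epsilon> * b)" for r
    proof -
      have "B \<le> \<epsilon> * (b * r)" using that \<epsilon> b_pos by (simp add: field_simps)
      also have "\<dots> \<le> \<epsilon> * exp (b * r)"
        using \<epsilon> exp_ge_add_one_self[of "b * r"] by (intro mult_left_mono) linarith+
      finally show ?thesis .
    qed
    then show "\<exists>R. \<forall>k\<le>L. \<forall>j. norm_1 (lattice_vec \<delta> j) \<ge> R \<longrightarrow>
            (\<Sum>m\<in>F. (w k (j + m))\<^sup>2) \<le> \<epsilon> * exp (b * norm_1 (lattice_vec \<delta> j))"
      using W_bounded unfolding B_def[symmetric] by (meson order_trans)
  qed (use bd_left bd_right F in auto)
  then show ?thesis by (simp add: M_def)
qed

section \<open>From the scaled lattice to the integer strip\<close>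

lemma Basis_vec_eq_range_axis: "(Basis :: (real ^ 'n) set) = range (\<lambda>i. axis i 1)"
  by (auto simp: Basis_vec_def)

lemma sum_Basis_real_vec:
  "(\<Sum>e\<in>(Basis :: (real \<times> (real ^ 'n)) set). f e) = f (1, 0) + (\<Sum>i\<in>UNIV. f (0, axis i 1))"
proof -
  have "inj_on (\<lambda>i::'n. axis i (1::real)) UNIV" by (auto simp: inj_on_def axis_eq_axis)
  then have "(\<Sum>e\<in>range (\<lambda>i. axis i 1). f (0, e)) = (\<Sum>i\<in>UNIV. f (0, axis i (1::real) :: real ^ 'n))"
    by (simp add: sum.reindex)
  then show ?thesis
    unfolding Basis_prod_def
    by (subst sum.union_disjoint)
       (auto simp: sum.reindex inj_on_def Basis_vec_eq_range_axis axis_eq_0_iff)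
qed

lemma lattice_vec_add_axis:
  "lattice_vec \<delta> (j + axis i 1) = lattice_vec \<delta> j + \<delta> *\<^sub>R axis i 1"
  by (simp add: lattice_vec_def vec_eq_iff axis_def algebra_simps)

lemma lattice_vec_diff_axis:
  "lattice_vec \<delta> (j - axis i 1) = lattice_vec \<delta> j - \<delta> *\<^sub>R axis i 1"
  by (simp add: lattice_vec_def vec_eq_iff axis_def algebra_simps)

lemma lattice_vec_in_scaled_lattice: "lattice_vec \<delta> j \<in> scaled_lattice \<delta>"
  by (auto simp: scaled_lattice_def lattice_vec_def Basis_vec_eq_range_axis inner_axis)

lemma discrete_harmonic_on_imp_strip_harmonic:
  fixes u :: "real \<times> (real ^ 'n) \<Rightarrow> real"
  assumes L: "L > 0" and \<delta>: "\<delta> = 1 / real L"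
    and harm: "discrete_harmonic_on \<delta> (discrete_strip \<delta>) u"
  shows "strip_harmonic L (\<lambda>k j. u (\<delta> * real k, lattice_vec \<delta> j))"
  unfolding strip_harmonic_def
proof (intro ballI allI)
  fix k and j :: "int ^ 'n"
  assume k: "k \<in> {1..<L}"
  let ?z = "(\<delta> * real k, lattice_vec \<delta> j)"
  have "\<exists>i::int. lattice_vec \<delta> j \<bullet> e = \<delta> * of_int i" if "e \<in> Basis" for e
    using lattice_vec_in_scaled_lattice[of \<delta> j] that unfolding scaled_lattice_def by blast
  moreover have "\<exists>i::int. \<delta> * real k = \<delta> * of_int i"
    by (rule exI[of _ "int k"]) simp
  ultimately have "?z \<in> scaled_lattice \<delta>"
    by (auto simp: scaled_lattice_def Basis_prod_def)
  then have "?z \<in> discrete_strip \<delta>"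
    using k L by (auto simp: discrete_strip_def \<delta> field_simps)
  then have "discrete_laplacian \<delta> u ?z = 0"
    using harm by (auto simp: discrete_harmonic_on_def)
  then have eq: "(\<Sum>e\<in>Basis. u (?z + \<delta> *\<^sub>R e) + u (?z - \<delta> *\<^sub>R e))
      = 2 * (real CARD('n) + 1) * u ?z"
    using L by (simp add: discrete_laplacian_def \<delta> algebra_simps)
  have "\<delta> * real (k - 1) = \<delta> * real k - \<delta>" "\<delta> * real (k + 1) = \<delta> * real k + \<delta>"
    using k by (auto simp: of_nat_diff algebra_simps)
  then show "2 * (real CARD('n) + 1) * u ?z
      = neighbour_sum (\<lambda>k j. u (\<delta> * real k, lattice_vec \<delta> j)) k j"
    unfolding eq[symmetric] sum_Basis_real_vec neighbour_sum_def
    by (simp add: lattice_vec_add_axis lattice_vec_diff_axis add.commute)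
qed

theorem theorem2:
  fixes L :: nat and \<delta> b :: real and u :: "real \<times> (real ^ 'n) \<Rightarrow> real"
  assumes L: "L \<ge> 2" and delta: "\<delta> = 1 / real L"
    and harmonic: "discrete_harmonic_on \<delta> (discrete_strip \<delta>) u"
    and b_pos: "b > 0"
    and b_eq: "cosh (\<delta> * b) =
      (real CARD('n) + 1) / real CARD('n) - 1 / real CARD('n) * cos (pi * \<delta>)"
    and growth: "little_o_exp L b u"
    and left: "(\<lambda>j :: int ^ 'n. \<bar>u (0, lattice_vec \<delta> j)\<bar>\<^sup>2) summable_on UNIV"
    and right: "(\<lambda>j :: int ^ 'n. \<bar>u (1, lattice_vec \<delta> j)\<bar>\<^sup>2) summable_on UNIV"
  shows "(\<forall>k\<in>{1..L - 1}.
           (\<lambda>j :: int ^ 'n. \<bar>u (\<delta> * real k, lattice_vec \<delta> j)\<bar>\<^sup>2) summable_on UNIV) \<and>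
         tempered L u \<and>
         (\<forall>k\<in>{1..L - 1}.
           (\<Sum>\<^sub>\<infinity>j :: int ^ 'n. \<bar>u (\<delta> * real k, lattice_vec \<delta> j)\<bar>\<^sup>2)
             \<le> (\<Sum>\<^sub>\<infinity>j :: int ^ 'n. \<bar>u (0, lattice_vec \<delta> j)\<bar>\<^sup>2)
               + (\<Sum>\<^sub>\<infinity>j :: int ^ 'n. \<bar>u (1, lattice_vec \<delta> j)\<bar>\<^sup>2))"
proof -
  define w where "w = (\<lambda>k j. u (\<delta> * real k, lattice_vec \<delta> j))"
  define A where "A = (\<Sum>\<^sub>\<infinity>j. (w 0 j)\<^sup>2)"
  define B where "B = (\<Sum>\<^sub>\<infinity>j. (w L j)\<^sup>2)"
  have L0: "L > 0" and \<delta>0: "\<delta> > 0" using L delta by auto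
  have w0: "w 0 j = u (0, lattice_vec \<delta> j)" and wL: "w L j = u (1, lattice_vec \<delta> j)" for j
    using L0 by (simp_all add: w_def delta)
  have A0: "A \<ge> 0" and B0: "B \<ge> 0" by (simp_all add: A_def B_def infsum_nonneg)
  have b_eq': "real CARD('n) * cosh (\<delta> * b) = real CARD('n) + 1 - cos (pi / real L)"
    unfolding b_eq by (simp add: delta field_simps)
  have fin_bound: "(\<Sum>j\<in>F. (w k j)\<^sup>2) \<le> A + B" if "k \<le> L" "finite F" for k F
  proof -
    have "(\<Sum>j\<in>F. (w k j)\<^sup>2) \<le> max A B"
      unfolding A_def B_def
    proof (rule strip_harmonic_sum_squares_le[OF L0 \<delta>0 b_pos b_eq'])
      show "strip_harmonic L w"
        unfolding w_def by (rule discrete_harmonic_on_imp_strip_harmonic[OF L0 delta harmonic])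
    next
      fix \<epsilon> :: real assume "\<epsilon> > 0"
      then obtain R where "\<And>k y. k \<in> {0..L} \<Longrightarrow> y \<in> scaled_lattice \<delta> \<Longrightarrow> norm_1 y \<ge> R \<Longrightarrow>
          \<bar>u (real k / real L, y)\<bar> \<le> \<epsilon> * exp (b * norm_1 y)"
        using growth unfolding little_o_exp_def delta by meson
      then show "\<exists>R. \<forall>k\<le>L. \<forall>j. norm_1 (lattice_vec \<delta> j) \<ge> R \<longrightarrow>
          \<bar>w k j\<bar> \<le> \<epsilon> * exp (b * norm_1 (lattice_vec \<delta> j))"
        by (intro exI[of _ R]) (simp add: w_def delta lattice_vec_in_scaled_lattice)
    qed (use left right that in \<open>simp_all add: w0 wL\<close>)
    then show ?thesis using A0 B0 by simp
  qed
  have summable: "(\<lambda>j. (w k j)\<^sup>2) summable_on UNIV" if "k \<le> L" for k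
    by (rule nonneg_bdd_above_summable_on)
       (use fin_bound[OF that] in \<open>auto intro!: bdd_aboveI2\<close>)
  have bound: "(\<Sum>\<^sub>\<infinity>j. (w k j)\<^sup>2) \<le> A + B" if "k \<le> L" for k
    by (rule infsum_le_finite_sums[OF summable[OF that]]) (use fin_bound[OF that] in auto)
  have "(\<lambda>(k, j). (w k j)\<^sup>2) summable_on ({0..L} \<times> UNIV)"
    by (rule summable_on_SigmaI[where g = "\<lambda>k. \<Sum>\<^sub>\<infinity>j. (w k j)\<^sup>2"])
       (use summable in \<open>auto intro: has_sum_infsum\<close>)
  then have "tempered L u"
    by (simp add: tempered_def w_def delta)
  then show ?thesis
    using summable bound unfolding A_def B_def w0 wL by (auto simp: w_def)
qed

end
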